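(* Let $2\le m\le n$ and let $A$ be an $m\times n$ array whose entries are independent uniform random real numbers in $[0,1)$. The expected effective entropy of 1-sided range maximum queries on $A$ (queries for the position of the maximum element of $A$ in $[1\cdots m]\times[1\cdots j]$, over all $1\le j\le n$) is $\Theta(\log^2 n)$ bits.
   Context: All logarithms are to base 2 and $\log^2 n=(\log n)^2$. Positions are given as (row, column), with rows $1,\dots,m$ and columns $1,\dots,n$. For a query range $q$, the answer is $\mathrm{RMQ}(A,q)=\mathrm{argmax}_{(i,j)\in q}A[i,j]$. Two arrays are equivalent with respect to a set of queries if they give the same answers to all queries in the set. An encoding maps arrays of known dimensions to bit strings so that all queries in the set can be answered from the bit string alone, without access to the array. The expected effective entropy, for a random array, is the minimum over all uniquely decodable encodings of the expected number of bits used; up to an additive constant it is the Shannon entropy of the random equivalence class of the array. *)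

theory Defs
  imports "HOL-Probability.Probability" "HOL-Library.Landau_Symbols"
begin

type_synonym position = "nat \<times> nat"

definition positions :: "nat \<Rightarrow> nat \<Rightarrow> position set" where
  "positions m n = {1..m} \<times> {1..n}"

definition arrays :: "nat \<Rightarrow> nat \<Rightarrow> (position \<Rightarrow> real) set" where
  "arrays m n = positions m n \<rightarrow>\<^sub>E UNIV"

text \<open>If several positions of \<open>q\<close> attain the maximum, \<^const>\<open>arg_max_on\<close> selects one of
  them, depending only on the set of maximising positions. For the random array considered
  below, ties have probability zero.\<close>

definition RMQ :: "(position \<Rightarrow> real) \<Rightarrow> position set \<Rightarrow> position" where
  "RMQ A q = arg_max_on A q"

definition one_sided_queries :: "nat \<Rightarrow> nat \<Rightarrow> position set set" where
  "one_sided_queries m n = (\<lambda>j. {1..m} \<times> {1..j}) ` {1..n}"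

text \<open>The dimensions are known to the decoder, so it may depend on \<open>m\<close> and \<open>n\<close>. Several
  bit strings may encode arrays with the same answers.\<close>

definition is_encoding ::
  "nat \<Rightarrow> nat \<Rightarrow> position set set \<Rightarrow> ((position \<Rightarrow> real) \<Rightarrow> bool list) \<Rightarrow> bool" where
  "is_encoding m n Q enc \<longleftrightarrow>
     (\<exists>dec. \<forall>A\<in>arrays m n. \<forall>q\<in>Q. dec (enc A) q = RMQ A q)"

definition uniquely_decodable :: "'b list set \<Rightarrow> bool" where
  "uniquely_decodable C \<longleftrightarrow> inj_on concat (lists C)"

definition random_array :: "nat \<Rightarrow> nat \<Rightarrow> (position \<Rightarrow> real) measure" where
  "random_array m n = PiM (positions m n) (\<lambda>_. uniform_measure lborel {0..<1})"

text \<open>\<open>M\<close> is the distribution of the random \<open>m \<times> n\<close> array. Measurability of the encoding is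
  required so that its expected number of bits is defined.\<close>

definition expected_effective_entropy ::
  "nat \<Rightarrow> nat \<Rightarrow> (position \<Rightarrow> real) measure \<Rightarrow> position set set \<Rightarrow> ennreal" where
  "expected_effective_entropy m n M Q =
     (INF enc \<in> {enc. is_encoding m n Q enc \<and> uniquely_decodable (enc ` arrays m n) \<and>
                      enc \<in> M \<rightarrow>\<^sub>M count_space UNIV}.
        \<integral>\<^sup>+ A. of_nat (length (enc A)) \<partial>M)"

end

theory Submission
  imports Defs "HOL-Analysis.Harmonic_Numbers"
begin

text \<open>Almost surely there are no ties, and the column of the maximum of the first \<open>j\<close> columns is
  uniform on \<open>{1..j}\<close> since exchanging two columns preserves the distribution of the array.

  Upper bound: it suffices to transmit the answer at those \<open>j\<close> where it changes. A change at \<open>j\<close>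
  has probability at most \<open>1 / j\<close>, so the expected number of changes is at most \<open>1 + ln n\<close>, and
  each costs \<open>O(log n)\<close> bits.

  Lower bound: the answers determine the column \<open>X\<^sub>k\<close> of the maximum of the first \<open>2 ^ k\<close>
  columns. Given the earlier \<open>X\<^sub>i\<close>, each value of \<open>X\<^sub>k\<close> above \<open>2 ^ (k - 1)\<close> has probability at
  most \<open>1 / 2 ^ (k - 1)\<close>, so a codeword \<open>w\<close> occurs with probability at most \<open>1 / 2 ^ W\<close>, where
  \<open>W\<close> sums \<open>k - 1\<close> over all \<open>k\<close> with \<open>X\<^sub>k > 2 ^ (k - 1)\<close>. Since \<open>1 / 4 ^ length w\<close> sums to
  \<open>2\<close> over all bit strings, the expectation of \<open>2 ^ W / 4 ^ length w\<close> is at most \<open>2\<close>. As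
  \<open>t \<le> 2 powr t\<close>, the expectation of \<open>W\<close>, which is of order \<open>(log 2 n)\<^sup>2\<close>, exceeds twice the
  expected length by at most \<open>2\<close>.\<close>

subsection \<open>Symmetry of the random array\<close>

definition left_block :: "nat \<Rightarrow> nat \<Rightarrow> position set" where
  "left_block m j = {1..m} \<times> {1..j}"

text \<open>Stated by strict comparison across columns rather than through \<open>RMQ\<close>, whose
  choice among ties does not commute with an exchange of columns. Ties inside column
  \<open>c\<close> do no harm.\<close>

definition max_column :: "nat \<Rightarrow> nat \<Rightarrow> nat \<Rightarrow> (position \<Rightarrow> real) \<Rightarrow> bool" where
  "max_column m j c A \<longleftrightarrow> c \<in> {1..j} \<and>
     (\<exists>r\<in>{1..m}. \<forall>r'\<in>{1..m}. \<forall>c'\<in>{1..j} - {c}. A (r', c') < A (r, c))"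

lemma one_sided_queries_eq: "one_sided_queries m n = left_block m ` {1..n}"
  by (simp add: one_sided_queries_def left_block_def)

lemma left_block_subset: "j \<le> n \<Longrightarrow> left_block m j \<subseteq> positions m n"
  by (auto simp: left_block_def positions_def)

lemma finite_positions [simp]: "finite (positions m n)"
  by (simp add: positions_def)

lemma finite_left_block [simp]: "finite (left_block m j)"
  by (simp add: left_block_def)

lemma RMQ_is_max:
  assumes "finite q" "q \<noteq> {}"
  shows "RMQ A q \<in> q" and "\<And>p. p \<in> q \<Longrightarrow> A p \<le> A (RMQ A q)"
proof -
  have "\<exists>x. is_arg_max A (\<lambda>x. x \<in> q) x"
    unfolding is_arg_max_linorder using Max_in[of "A ` q"] Max_ge[of "A ` q"] assms by fastforce
  then have "is_arg_max A (\<lambda>x. x \<in> q) (RMQ A q)"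
    unfolding RMQ_def arg_max_on_def arg_max_def by (rule someI_ex)
  then show "RMQ A q \<in> q" and "\<And>p. p \<in> q \<Longrightarrow> A p \<le> A (RMQ A q)"
    by (auto simp: is_arg_max_linorder)
qed

text \<open>Exposes the set of maximisers, so that arrays with the same comparisons between entries
  get the same answers.\<close>

lemma RMQ_eq_Eps: "RMQ A q = (SOME x. x \<in> q \<and> (\<forall>y\<in>q. A y \<le> A x))"
  unfolding RMQ_def arg_max_on_def arg_max_def is_arg_max_linorder by (simp add: Ball_def)

lemma max_column_unique: "max_column m j c A \<Longrightarrow> max_column m j c' A \<Longrightarrow> c = c'"
  unfolding max_column_def
  by (metis (no_types, lifting) DiffI less_asym singletonD)

lemma max_column_RMQ:
  assumes "inj_on A (positions m n)" "1 \<le> m" "j \<in> {1..n}"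
  shows "max_column m j (snd (RMQ A (left_block m j))) A"
proof -
  let ?p = "RMQ A (left_block m j)"
  have ne: "left_block m j \<noteq> {}" using assms by (auto simp: left_block_def)
  have p: "?p \<in> left_block m j" "\<And>q. q \<in> left_block m j \<Longrightarrow> A q \<le> A ?p"
    using RMQ_is_max[OF finite_left_block ne] by blast+
  have sub: "left_block m j \<subseteq> positions m n" using assms left_block_subset by auto
  have "A (r', c') < A ?p" if "r' \<in> {1..m}" "c' \<in> {1..j} - {snd ?p}" for r' c'
  proof -
    have "(r', c') \<in> left_block m j" using that by (auto simp: left_block_def)
    moreover have "(r', c') \<noteq> ?p" using that by (metis DiffE insertI1 snd_conv)
    ultimately show ?thesis
      using p sub assms(1) by (metis inj_onD less_eq_real_def subsetD)
  qed
  then show ?thesis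
    using p(1) unfolding max_column_def
    by (intro conjI bexI[of _ "fst ?p"]) (auto simp: left_block_def)
qed

section \<open>The product measure: no ties, and invariance under exchange of columns\<close>

abbreviation unit_uniform :: "real measure" where
  "unit_uniform \<equiv> uniform_measure lborel {0..<1}"

lemma prob_space_unit_uniform: "prob_space unit_uniform"
  by (rule prob_space_uniform_measure) auto

lemma prob_space_random_array: "prob_space (random_array m n)"
  unfolding random_array_def by (intro prob_space_PiM prob_space_unit_uniform)

lemma space_random_array [simp]: "space (random_array m n) = arrays m n"
  by (simp add: random_array_def space_PiM arrays_def)

lemma measurable_entry [measurable]:
  "p \<in> positions m n \<Longrightarrow> (\<lambda>A. A p) \<in> borel_measurable (random_array m n)"
  unfolding random_array_def
  using measurable_component_singleton[of p "positions m n" "\<lambda>_. unit_uniform"] by simp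

text \<open>By Fubini: with all other entries fixed, a tie of \<open>p\<close> with
  \<open>p'\<close> forces the entry at \<open>p\<close> to a single value, a null event for the
  uniform distribution. There are finitely many pairs.\<close>

lemma AE_random_array_inj: "AE A in random_array m n. inj_on A (positions m n)"
proof -
  let ?P = "positions m n"
  interpret U: prob_space unit_uniform by (rule prob_space_unit_uniform)
  interpret product_sigma_finite "\<lambda>_::position. unit_uniform" ..
  have "AE A in random_array m n. A p \<noteq> A p'" if p: "p \<in> ?P" "p' \<in> ?P" "p \<noteq> p'" for p p'
  proof -
    have 0: "emeasure unit_uniform {x} = 0" for x
      by (simp add: emeasure_uniform_measure_1 uniform_measure_def emeasure_density)
    have ins: "insert p (?P - {p}) = ?P" using p by auto
    let ?f = "\<lambda>A::position \<Rightarrow> real. indicator {A. A p = A p'} A :: ennreal"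
    have meas [measurable]: "?f \<in> borel_measurable (random_array m n)"
      by (intro borel_measurable_indicator') (use borel_measurable_eq[OF measurable_entry[OF p(1)] measurable_entry[OF p(2)]] in auto)
    have "integral\<^sup>N (random_array m n) ?f
        = (\<integral>\<^sup>+ A. \<integral>\<^sup>+ y. ?f (A(p := y)) \<partial>unit_uniform \<partial>PiM (?P - {p}) (\<lambda>_. unit_uniform))"
      using product_nn_integral_insert[of "?P - {p}" p ?f] meas
      unfolding random_array_def ins by simp
    also have "\<dots> = 0"
    proof -
      have "(\<integral>\<^sup>+ y. ?f (A(p := y)) \<partial>unit_uniform) = 0" for A
      proof -
        have "(\<integral>\<^sup>+ y. ?f (A(p := y)) \<partial>unit_uniform)
            = (\<integral>\<^sup>+ y. indicator {A p'} y \<partial>unit_uniform)"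
          using p by (intro nn_integral_cong) (auto split: split_indicator)
        then show ?thesis using 0 by simp
      qed
      then show ?thesis by simp
    qed
    finally have "AE A in random_array m n. ?f A = 0"
      by (subst (asm) nn_integral_0_iff_AE) auto
    then show ?thesis by eventually_elim (auto split: split_indicator_asm)
  qed
  then have "AE A in random_array m n. \<forall>p\<in>?P. \<forall>p'\<in>?P. p \<noteq> p' \<longrightarrow> A p \<noteq> A p'"
    by (intro AE_finite_allI AE_impI) auto
  then show ?thesis by eventually_elim (auto simp: inj_on_def)
qed

lemma measurable_max_column [measurable]:
  assumes "j \<le> n"
  shows "Measurable.pred (random_array m n) (max_column m j c)"
proof (cases "c \<in> {1..j}")
  case True
  have [measurable]: "(\<lambda>A. A (r, d)) \<in> borel_measurable (random_array m n)"
    if "r \<in> {1..m}" "d \<in> {1..j}" for r d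
    using that assms by (intro measurable_entry) (auto simp: positions_def)
  show ?thesis
    unfolding max_column_def using True by simp measurable
next
  case False
  then have "max_column m j c = (\<lambda>_. False)" by (auto simp: max_column_def)
  then show ?thesis by simp
qed

text \<open>The restriction to \<open>positions m n\<close> keeps the result extensional, hence in
  the space of the product measure.\<close>

definition swap_columns :: "nat \<Rightarrow> nat \<Rightarrow> nat \<Rightarrow> nat \<Rightarrow> (position \<Rightarrow> real) \<Rightarrow> position \<Rightarrow> real" where
  "swap_columns m n c c' A = (\<lambda>p\<in>positions m n. A (fst p, Transposition.transpose c c' (snd p)))"

lemma swap_columns_apply:
  "r \<in> {1..m} \<Longrightarrow> d \<in> {1..n} \<Longrightarrow> swap_columns m n c c' A (r, d) = A (r, Transposition.transpose c c' d)"
  by (simp add: swap_columns_def positions_def)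

text \<open>The entries are independent and identically distributed, so reindexing the coordinates
  injectively preserves the product measure.\<close>

lemma
  assumes "c \<in> {1..n}" "c' \<in> {1..n}"
  shows measurable_swap_columns:
      "swap_columns m n c c' \<in> random_array m n \<rightarrow>\<^sub>M random_array m n"
    and distr_swap_columns:
      "distr (random_array m n) (random_array m n) (swap_columns m n c c') = random_array m n"
proof -
  let ?f = "\<lambda>p::position. (fst p, Transposition.transpose c c' (snd p))"
  have inj: "inj_on ?f (positions m n)"
    by (auto simp: inj_on_def dest: injD[OF inj_transpose])
  have into: "?f \<in> positions m n \<rightarrow> positions m n"
    using assms by (auto simp: positions_def Transposition.transpose_def)
  have eq: "swap_columns m n c c' = (\<lambda>A. \<lambda>p\<in>positions m n. A (?f p))"
    by (auto simp: swap_columns_def fun_eq_iff)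
  show "swap_columns m n c c' \<in> random_array m n \<rightarrow>\<^sub>M random_array m n"
    unfolding eq random_array_def using into
    by (intro measurable_restrict measurable_component_singleton) auto
  show "distr (random_array m n) (random_array m n) (swap_columns m n c c') = random_array m n"
    unfolding eq random_array_def
    by (rule distr_PiM_reindex[OF prob_space_unit_uniform inj into])
qed

text \<open>Both columns lie in the block, so the transposition permutes \<open>{1..j}\<close> and
  merely relabels the columns compared.\<close>

lemma max_column_swap:
  assumes j: "j \<le> n" and "c \<in> {1..j}" "c' \<in> {1..j}"
  shows "max_column m j d (swap_columns m n c c' A) \<longleftrightarrow> max_column m j (Transposition.transpose c c' d) A"
proof -
  let ?t = "Transposition.transpose c c'"
  have t: "?t x \<in> {1..j} \<longleftrightarrow> x \<in> {1..j}" for x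
    using assms unfolding Transposition.transpose_def by (auto split: if_splits)
  have img: "?t ` ({1..j} - {d}) = {1..j} - {?t d}"
  proof (intro set_eqI iffI)
    fix x assume "x \<in> {1..j} - {?t d}"
    then have "?t x \<in> {1..j} - {d}" "x = ?t (?t x)" using t by (auto simp del: atLeastAtMost_iff)
    then show "x \<in> ?t ` ({1..j} - {d})" by blast
  qed (use t in \<open>auto simp del: atLeastAtMost_iff dest: transpose_eq_imp_eq\<close>)
  have app: "swap_columns m n c c' A (r, x) = A (r, ?t x)" if "r \<in> {1..m}" "x \<in> {1..j}" for r x
    using that j by (intro swap_columns_apply) auto
  have "max_column m j d (swap_columns m n c c' A) \<longleftrightarrow> d \<in> {1..j} \<and>
      (\<exists>r\<in>{1..m}. \<forall>r'\<in>{1..m}. \<forall>x\<in>{1..j} - {d}. A (r', ?t x) < A (r, ?t d))"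
    unfolding max_column_def by (intro conj_cong refl bex_cong ball_cong) (metis app DiffD1)
  also have "\<dots> \<longleftrightarrow> max_column m j (?t d) A"
    unfolding max_column_def t img[symmetric] by blast
  finally show ?thesis .
qed

text \<open>Both columns lie to the right of the block, whose entries are therefore
  unchanged.\<close>

lemma max_column_swap_outside:
  assumes "j \<le> n" "j < c" "j < c'"
  shows "max_column m j d (swap_columns m n c c' A) \<longleftrightarrow> max_column m j d A"
proof -
  have "swap_columns m n c c' A (r, x) = A (r, x)" if "r \<in> {1..m}" "x \<in> {1..j}" for r x
    using that assms by (subst swap_columns_apply) (auto simp: Transposition.transpose_def)
  then show ?thesis
    unfolding max_column_def by (intro conj_cong refl bex_cong ball_cong) auto
qed

text \<open>The symmetry argument: over \<open>d\<close> in \<open>C\<close>, the events that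
  \<open>Q\<close> holds and \<open>d\<close> is the maximum column are disjoint, equally likely and
  contained in \<open>Q\<close>. The condition \<open>Q\<close> serves to carry what is known about
  smaller blocks.\<close>

lemma prob_max_column_le:
  assumes "j \<le> n" "C \<subseteq> {1..j}" "c \<in> C"
    and Q [measurable]: "Measurable.pred (random_array m n) Q"
    and inv: "\<And>c' A. c' \<in> C \<Longrightarrow> A \<in> arrays m n \<Longrightarrow> Q (swap_columns m n c c' A) \<longleftrightarrow> Q A"
  shows "card C * measure (random_array m n) {A \<in> arrays m n. Q A \<and> max_column m j c A}
       \<le> measure (random_array m n) {A \<in> arrays m n. Q A}"
proof -
  let ?M = "random_array m n"
  interpret prob_space ?M by (rule prob_space_random_array)
  let ?E = "\<lambda>d. {A \<in> arrays m n. Q A \<and> max_column m j d A}"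
  note [measurable] = measurable_max_column[OF assms(1)]
  have E [measurable]: "?E d \<in> events" for d
    unfolding space_random_array[symmetric] by measurable
  have Qe: "{A \<in> arrays m n. Q A} \<in> events"
    unfolding space_random_array[symmetric] by measurable
  have eq: "prob (?E d) = prob (?E c)" if "d \<in> C" for d
  proof -
    have cd: "c \<in> {1..j}" "d \<in> {1..j}" using that assms by auto
    then have cd': "c \<in> {1..n}" "d \<in> {1..n}" using assms by auto
    note T = measurable_swap_columns[OF cd', of m]
    have "prob (?E d) = measure (distr ?M ?M (swap_columns m n c d)) (?E d)"
      by (simp add: distr_swap_columns[OF cd'])
    also have "\<dots> = prob (swap_columns m n c d -` ?E d \<inter> space ?M)"
      by (rule measure_distr[OF T E])
    \<comment> \<open>Exchanging \<open>c\<close> and \<open>d\<close> preserves \<open>Q\<close>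
      and turns maximum column \<open>d\<close> into \<open>c\<close>.\<close>
    also have "swap_columns m n c d -` ?E d \<inter> space ?M = ?E c"
      using measurable_space[OF T] inv[OF that] max_column_swap[OF assms(1) cd, of m d] by auto
    finally show ?thesis .
  qed
  have fin: "finite C" using assms finite_subset by blast
  have "card C * prob (?E c) = (\<Sum>d\<in>C. prob (?E d))" using eq by simp
  also have "\<dots> = prob (\<Union>d\<in>C. ?E d)"
    using E by (intro finite_measure_finite_Union[symmetric] fin)
       (auto simp: disjoint_family_on_def dest: max_column_unique)
  also have "\<dots> \<le> prob {A \<in> arrays m n. Q A}"
    using Qe by (intro finite_measure_mono) auto
  finally show ?thesis .
qed

text \<open>The case of a trivial condition, with \<open>C\<close> the whole range of
  columns.\<close>

lemma prob_max_column_le_inverse: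
  assumes "j \<le> n" "c \<in> {1..j}"
  shows "measure (random_array m n) {A \<in> arrays m n. max_column m j c A} \<le> 1 / j"
proof -
  interpret prob_space "random_array m n" by (rule prob_space_random_array)
  have "card {1..j} * prob {A \<in> arrays m n. True \<and> max_column m j c A}
      \<le> prob {A \<in> arrays m n. True}"
    by (rule prob_max_column_le) (use assms in auto)
  also have "\<dots> \<le> 1" by simp
  finally show ?thesis using assms by (simp add: field_simps)
qed

subsection \<open>Lower bound\<close>

text \<open>Here \<open>x k\<close> stands for the maximum column of the first \<open>2 ^ k\<close>
  columns. The summand \<open>k - 1\<close> is the binary logarithm of the number of columns in the
  right half of that block.\<close>

definition dyadic_weight :: "nat \<Rightarrow> (nat \<Rightarrow> nat) \<Rightarrow> nat" where
  "dyadic_weight K x = (\<Sum>k=1..K. if 2 ^ (k - 1) < x k then k - 1 else 0)"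

lemma two_power_le: "2 ^ K \<le> n \<Longrightarrow> k \<le> K \<Longrightarrow> 2 ^ k \<le> (n :: nat)"
  by (meson one_le_numeral order_trans power_increasing)

text \<open>Induction on the number of blocks: exchanging two columns in the right half of the new
  block leaves all earlier blocks alone, so prescribing a column there costs a factor
  \<open>2 ^ K\<close>.\<close>

lemma prob_dyadic_max_columns:
  assumes "2 ^ K \<le> n"
  shows "2 ^ dyadic_weight K x *
    measure (random_array m n) {A \<in> arrays m n. \<forall>k\<in>{1..K}. max_column m (2 ^ k) (x k) A} \<le> 1"
  using assms
proof (induction K)
  case 0
  interpret prob_space "random_array m n" by (rule prob_space_random_array)
  show ?case by (simp add: dyadic_weight_def)
next
  case (Suc K)
  let ?M = "random_array m n"
  interpret prob_space ?M by (rule prob_space_random_array)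
  let ?Q = "\<lambda>A. \<forall>k\<in>{1..K}. max_column m (2 ^ k) (x k) A"
  let ?y = "x (Suc K)"
  let ?E = "{A \<in> arrays m n. ?Q A \<and> max_column m (2 ^ Suc K) ?y A}"
  have le: "2 ^ k \<le> n" if "k \<le> Suc K" for k
    using two_power_le[OF Suc.prems that] .
  have Q [measurable]: "Measurable.pred ?M ?Q"
    using le by (intro pred_intros_finite measurable_max_column) auto
  have Qe: "{A \<in> arrays m n. ?Q A} \<in> events"
    unfolding space_random_array[symmetric] by measurable
  have IH: "2 ^ dyadic_weight K x * prob {A \<in> arrays m n. ?Q A} \<le> 1"
    using Suc by simp
  have E: "{A \<in> arrays m n. \<forall>k\<in>{1..Suc K}. max_column m (2 ^ k) (x k) A} = ?E"
    by (auto simp: atLeastAtMostSuc_conv simp del: power_Suc)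
  have w: "dyadic_weight (Suc K) x = dyadic_weight K x + (if 2 ^ K < ?y then K else 0)"
    by (simp add: dyadic_weight_def)
  have mono: "prob ?E \<le> prob {A \<in> arrays m n. ?Q A}"
    using Qe by (intro finite_measure_mono) auto
  \<comment> \<open>In the left half no weight is added and monotonicity suffices; the right half
    needs the symmetry; beyond the block the event is empty.\<close>
  consider "?y \<le> 2 ^ K" | "?y \<in> {2 ^ K<..2 ^ Suc K}" | "2 ^ Suc K < ?y" by fastforce
  then show ?case
  proof cases
    case 1
    then show ?thesis
      unfolding E w using mono IH by (smt (verit) add_0_right linorder_not_less mult_left_mono zero_le_power)
  next
    case 2
    have "card {2 ^ K<..2 ^ Suc K :: nat} * prob ?E \<le> prob {A \<in> arrays m n. ?Q A}"
    proof (rule prob_max_column_le[OF _ _ 2 Q])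
      fix c A assume c: "c \<in> {2 ^ K<..2 ^ Suc K :: nat}"
      have "max_column m (2 ^ k) (x k) (swap_columns m n ?y c A) \<longleftrightarrow> max_column m (2 ^ k) (x k) A"
        if "k \<in> {1..K}" for k
      proof -
        have "2 ^ k \<le> (2 ^ K :: nat)" using that by (intro power_increasing) auto
        then have "2 ^ k < ?y" "2 ^ k < c"
          using 2 c by (meson greaterThanAtMost_iff le_less_trans)+
        then show ?thesis
          using that le by (intro max_column_swap_outside) auto
      qed
      then show "?Q (swap_columns m n ?y c A) \<longleftrightarrow> ?Q A" by blast
    qed (use Suc.prems in auto)
    then have "2 ^ K * prob ?E \<le> prob {A \<in> arrays m n. ?Q A}" by simp
    then have "2 ^ dyadic_weight K x * (2 ^ K * prob ?E) \<le> 1"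
      using IH by (meson mult_left_mono order_trans zero_le_numeral zero_le_power)
    then show ?thesis
      unfolding E w using 2 by (simp add: power_add mult.assoc)
  next
    case 3
    then have "?E = {}" by (auto simp: max_column_def)
    then show ?thesis unfolding E by (simp only: measure_empty)
  qed
qed

text \<open>Grouped by length, the \<open>2 ^ k\<close> words of length \<open>k\<close> contribute
  \<open>(1/2) ^ k\<close>. With base 2 in place of 4 the sum over all words would diverge; base 4
  costs a factor 2 on the length.\<close>

lemma nn_integral_quarter_power_length:
  "(\<integral>\<^sup>+ w. ennreal ((1/4) ^ length w) \<partial>count_space (UNIV :: bool list set)) = 2"
proof -
  have card: "card {w :: bool list. length w = k} = 2 ^ k" "finite {w :: bool list. length w = k}" for k
    using card_lists_length_eq[of "UNIV :: bool set" k] finite_lists_length_eq[of "UNIV :: bool set" k]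
    by simp_all
  have "(\<integral>\<^sup>+ w. ennreal ((1/4) ^ length w) \<partial>count_space (UNIV :: bool list set)) =
      (\<integral>\<^sup>+ w. \<integral>\<^sup>+ k. ennreal ((1/4) ^ k) * indicator {length w} k
      \<partial>count_space UNIV \<partial>count_space (UNIV :: bool list set))"
    by (intro nn_integral_cong) (simp add: nn_integral_cmult_indicator nn_integral_count_space_indicator[symmetric])
  also have "\<dots> = (\<integral>\<^sup>+ k. \<integral>\<^sup>+ w. ennreal ((1/4) ^ k) * indicator {length w} k
      \<partial>count_space (UNIV :: bool list set) \<partial>count_space UNIV)"
    by (rule nn_integral_count_space_nn_integral) auto
  also have "\<dots> = (\<integral>\<^sup>+ k. ennreal ((1/2) ^ k) \<partial>count_space UNIV)"
  proof (rule nn_integral_cong)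
    fix k :: nat
    have "(\<integral>\<^sup>+ w. ennreal ((1/4) ^ k) * indicator {length w} k \<partial>count_space (UNIV :: bool list set))
        = (\<integral>\<^sup>+ w. ennreal ((1/4) ^ k) * indicator {w. length w = k} w
          \<partial>count_space (UNIV :: bool list set))"
      by (intro nn_integral_cong) (simp split: split_indicator)
    also have "\<dots> = ennreal ((1/4) ^ k) * of_nat (2 ^ k)"
      by (simp add: nn_integral_cmult_indicator card emeasure_count_space)
    also have "\<dots> = ennreal ((1/4) ^ k * 2 ^ k)"
      by (simp add: ennreal_mult'' flip: ennreal_power)
    also have "(1/4) ^ k * 2 ^ k = (1/2 :: real) ^ k"
      by (simp flip: power_mult_distrib)
    finally show "(\<integral>\<^sup>+ w. ennreal ((1/4) ^ k) * indicator {length w} k \<partial>count_space (UNIV :: bool list set))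
      = ennreal ((1/2) ^ k)" .
  qed
  also have "\<dots> = ennreal (\<Sum>k. (1/2) ^ k)"
    by (simp add: nn_integral_count_space_nat suminf_ennreal2 summable_geometric)
  also have "\<dots> = 2" by (simp add: suminf_geometric)
  finally show ?thesis .
qed

text \<open>The maximum of each dyadic block lies in its right half with probability at least
  \<open>1 / 2\<close>, so the expected weight is at least the sum of
  \<open>(k - 1) / 2\<close>.\<close>

lemma nn_integral_dyadic_weight_ge:
  assumes "2 ^ K \<le> n" "1 \<le> m"
  shows "ennreal (real K * (real K - 1) / 4) \<le>
    (\<integral>\<^sup>+ A. ennreal (dyadic_weight K (\<lambda>k. snd (RMQ A (left_block m (2 ^ k))))) \<partial>random_array m n)"
proof -
  let ?M = "random_array m n"
  interpret prob_space ?M by (rule prob_space_random_array)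
  let ?X = "\<lambda>k A. snd (RMQ A (left_block m (2 ^ k)))"
  let ?N = "\<lambda>k A. \<exists>c\<in>{1..2 ^ (k - 1)}. max_column m (2 ^ k) c A"
  let ?F = "\<lambda>k. {A \<in> arrays m n. \<not> ?N k A}"
  have le: "2 ^ k \<le> n" if "k \<le> K" for k
    using two_power_le[OF assms(1) that] .
  have mx [measurable]: "Measurable.pred ?M (max_column m (2 ^ k) c)" if "k \<in> {1..K}" for k c
    using that le by (intro measurable_max_column) auto
  have F [measurable]: "?F k \<in> events" if "k \<in> {1..K}" for k
    using mx[OF that] unfolding space_random_array[symmetric] by measurable
  \<comment> \<open>Union bound: the left half has \<open>2 ^ (k - 1)\<close> columns, each of
    probability at most \<open>1 / 2 ^ k\<close>.\<close>
  have half: "1 / 2 \<le> prob (?F k)" if k: "k \<in> {1..K}" for k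
  proof -
    let ?S = "\<lambda>c. {A \<in> arrays m n. max_column m (2 ^ k) c A}"
    have S: "?S c \<in> events" for c
      using mx[OF k, of c] unfolding space_random_array[symmetric] by measurable
    have k2: "2 ^ k = 2 * (2 ^ (k - 1) :: nat)" using k by (cases k) auto
    have "prob (\<Union>c\<in>{1..2 ^ (k - 1)}. ?S c) \<le> (\<Sum>c=1..2 ^ (k - 1). prob (?S c))"
      using S by (intro finite_measure_subadditive_finite) auto
    also have "\<dots> \<le> (\<Sum>c=1..(2::nat) ^ (k - 1). 1 / real (2 ^ k))"
      using k le[of k] k2 by (intro sum_mono prob_max_column_le_inverse) auto
    also have "\<dots> = 1 / 2" using k2 by (simp add: field_simps)
    finally have "prob (space ?M - (\<Union>c\<in>{1..2 ^ (k - 1)}. ?S c)) \<ge> 1 / 2"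
      using S by (subst prob_compl) auto
    also have "space ?M - (\<Union>c\<in>{1..2 ^ (k - 1)}. ?S c) = ?F k" by auto
    finally show ?thesis .
  qed
  have "real K * (real K - 1) / 4 = (\<Sum>k=1..K. real (k - 1) * (1 / 2))"
    by (induction K) (auto simp: field_simps)
  also have "\<dots> \<le> (\<Sum>k=1..K. real (k - 1) * prob (?F k))"
    using half by (intro sum_mono mult_left_mono) auto
  finally have "ennreal (real K * (real K - 1) / 4) \<le> ennreal (\<Sum>k=1..K. real (k - 1) * prob (?F k))"
    by (rule ennreal_leI)
  also have "\<dots> = (\<Sum>k=1..K. ennreal (real (k - 1)) * emeasure ?M (?F k))"
    unfolding emeasure_eq_measure
    by (subst sum_ennreal[symmetric]) (auto intro!: sum.cong simp: ennreal_mult[symmetric])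
  also have "\<dots> = (\<Sum>k=1..K. \<integral>\<^sup>+ A. ennreal (real (k - 1)) * indicator (?F k) A \<partial>?M)"
    using F by (intro sum.cong refl) (simp add: nn_integral_cmult_indicator)
  also have "\<dots> = (\<integral>\<^sup>+ A. (\<Sum>k=1..K. ennreal (real (k - 1)) * indicator (?F k) A) \<partial>?M)"
    using F by (intro nn_integral_sum[symmetric]) measurable
  also have "\<dots> \<le> (\<integral>\<^sup>+ A. ennreal (dyadic_weight K (\<lambda>k. ?X k A)) \<partial>?M)"
  proof (rule nn_integral_mono_AE)
    show "AE A in ?M. (\<Sum>k=1..K. ennreal (real (k - 1)) * indicator (?F k) A)
        \<le> ennreal (dyadic_weight K (\<lambda>k. ?X k A))"
      using AE_random_array_inj[of m n]
    proof eventually_elim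
      case (elim A)
      \<comment> \<open>Without ties the column of the answer is a maximum column; it is not in the
        left half, hence in the right.\<close>
      have "2 ^ (k - 1) < ?X k A" if "k \<in> {1..K}" "A \<in> ?F k" for k
      proof (rule ccontr)
        assume "\<not> 2 ^ (k - 1) < ?X k A"
        moreover have "max_column m (2 ^ k) (?X k A) A"
          using that le assms by (intro max_column_RMQ[OF elim]) auto
        moreover from this have "1 \<le> ?X k A" by (simp add: max_column_def)
        ultimately show False using that by auto
      qed
      then have "(\<Sum>k=1..K. ennreal (real (k - 1)) * indicator (?F k) A)
          \<le> (\<Sum>k=1..K. ennreal (real (if 2 ^ (k - 1) < ?X k A then k - 1 else 0)))"
        by (intro sum_mono) (auto split: split_indicator)
      then show ?case by (simp add: dyadic_weight_def)
    qed
  qed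
  finally show ?thesis .
qed

text \<open>Split by the codeword \<open>w\<close>: it fixes the columns \<open>g w k\<close>, so
  its probability cancels the factor \<open>2 ^ dyadic_weight K (g w)\<close>, and
  \<open>(1/4) ^ length w\<close> remains to be summed.\<close>

lemma nn_integral_dyadic_weight_le:
  assumes "2 ^ K \<le> n" "1 \<le> m"
    and enc [measurable]: "enc \<in> random_array m n \<rightarrow>\<^sub>M count_space UNIV"
    and dec: "\<And>A k. A \<in> arrays m n \<Longrightarrow> k \<in> {1..K} \<Longrightarrow> snd (RMQ A (left_block m (2 ^ k))) = g (enc A) k"
  shows "(\<integral>\<^sup>+ A. ennreal (2 ^ dyadic_weight K (g (enc A)) * (1/4) ^ length (enc A :: bool list))
    \<partial>random_array m n) \<le> 2"
proof -
  let ?M = "random_array m n"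
  interpret prob_space ?M by (rule prob_space_random_array)
  let ?h = "\<lambda>w. ennreal (2 ^ dyadic_weight K (g w) * (1/4) ^ length w)"
  have le: "2 ^ k \<le> n" if "k \<le> K" for k
    using two_power_le[OF assms(1) that] .
  have ev [measurable]: "enc -` {w} \<inter> space ?M \<in> events" for w
    using measurable_sets[OF enc, of "{w}"] by simp
  have "(\<integral>\<^sup>+ A. ?h (enc A) \<partial>?M)
      = (\<integral>\<^sup>+ A. \<integral>\<^sup>+ w. ?h w * indicator (enc -` {w} \<inter> space ?M) A \<partial>count_space UNIV \<partial>?M)"
  proof (rule nn_integral_cong)
    fix A assume "A \<in> space ?M"
    then have "(\<integral>\<^sup>+ w. ?h w * indicator (enc -` {w} \<inter> space ?M) A \<partial>count_space UNIV)
        = (\<integral>\<^sup>+ w. ?h w * indicator {enc A} w \<partial>count_space UNIV)"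
      by (intro nn_integral_cong) (auto split: split_indicator)
    also have "\<dots> = ?h (enc A)" by (simp add: nn_integral_count_space_indicator[symmetric])
    finally show "?h (enc A) = (\<integral>\<^sup>+ w. ?h w * indicator (enc -` {w} \<inter> space ?M) A \<partial>count_space UNIV)" ..
  qed
  also have "\<dots> = (\<integral>\<^sup>+ w. \<integral>\<^sup>+ A. ?h w * indicator (enc -` {w} \<inter> space ?M) A \<partial>?M \<partial>count_space UNIV)"
    by (intro nn_integral_count_space_nn_integral) (auto simp del: space_random_array)
  also have "\<dots> \<le> (\<integral>\<^sup>+ w. ennreal ((1/4) ^ length w) \<partial>count_space (UNIV :: bool list set))"
  proof (rule nn_integral_mono)
    fix w :: "bool list"
    let ?E = "{A \<in> arrays m n. \<forall>k\<in>{1..K}. max_column m (2 ^ k) (g w k) A}"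
    have "Measurable.pred ?M (\<lambda>A. \<forall>k\<in>{1..K}. max_column m (2 ^ k) (g w k) A)"
      using le by (intro pred_intros_finite measurable_max_column) auto
    then have E: "?E \<in> events" unfolding space_random_array[symmetric] by measurable
    \<comment> \<open>The inclusion is shown only outside the null set of arrays with ties.\<close>
    have "emeasure ?M (enc -` {w} \<inter> space ?M) \<le> emeasure ?M ?E"
    proof (rule emeasure_mono_AE[OF _ E])
      show "AE A in ?M. A \<in> enc -` {w} \<inter> space ?M \<longrightarrow> A \<in> ?E"
        using AE_random_array_inj[of m n]
      proof eventually_elim
        case (elim A)
        have "max_column m (2 ^ k) (g w k) A" if "k \<in> {1..K}" "A \<in> enc -` {w} \<inter> space ?M" for k
          using max_column_RMQ[OF elim assms(2), of "2 ^ k"] dec[of A k] that le by auto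
        then show ?case by auto
      qed
    qed
    then have "?h w * emeasure ?M (enc -` {w} \<inter> space ?M) \<le> ?h w * ennreal (prob ?E)"
      by (intro mult_left_mono) (auto simp: emeasure_eq_measure)
    also have "\<dots> = ennreal ((2 ^ dyadic_weight K (g w) * prob ?E) * (1/4) ^ length w)"
      by (simp add: ac_simps flip: ennreal_mult)
    also have "\<dots> \<le> ennreal ((1/4) ^ length w)"
      using mult_right_mono[OF prob_dyadic_max_columns[OF assms(1), of "g w" m], of "(1/4) ^ length w"]
      by (intro ennreal_leI) simp
    finally show "(\<integral>\<^sup>+ A. ?h w * indicator (enc -` {w} \<inter> space ?M) A \<partial>?M) \<le> ennreal ((1/4) ^ length w)"
      by (subst nn_integral_cmult_indicator) (auto simp del: space_random_array)
  qed
  finally show ?thesis by (simp add: nn_integral_quarter_power_length)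
qed

section \<open>From expected weight to expected length\<close>

text \<open>An empty codeword could be inserted anywhere without being noticed. The resulting
  minimum length of one bit absorbs additive constants in the lower bound.\<close>

lemma nonempty_codeword:
  assumes "uniquely_decodable C" "w \<in> C"
  shows "w \<noteq> []"
proof
  assume "w = []"
  then have "concat [w] = concat []" by simp
  then show False
    using assms inj_onD[of concat "lists C" "[w]" "[]"] by (auto simp: uniquely_decodable_def)
qed

lemma expected_length_ge:
  assumes "2 \<le> m" "m \<le> n" "is_encoding m n (one_sided_queries m n) enc"
    and ud: "uniquely_decodable (enc ` arrays m n)"
    and enc [measurable]: "enc \<in> random_array m n \<rightarrow>\<^sub>M count_space UNIV"
  shows "ennreal ((log 2 n)\<^sup>2 / 41) \<le> (\<integral>\<^sup>+ A. of_nat (length (enc A)) \<partial>random_array m n)"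
proof -
  let ?M = "random_array m n"
  interpret prob_space ?M by (rule prob_space_random_array)
  \<comment> \<open>The largest dyadic block that fits into the \<open>n\<close> columns.\<close>
  define K where "K = nat \<lfloor>log 2 n\<rfloor>"
  let ?I = "\<integral>\<^sup>+ A. of_nat (length (enc A)) \<partial>?M"
  have n: "2 \<le> n" using assms by simp
  have log1: "1 \<le> log 2 n" using n by (simp add: le_log_iff)
  have K: "1 \<le> K" "real K \<le> log 2 n" "log 2 n < real K + 1"
    using log1 unfolding K_def by linarith+
  have "2 ^ K \<le> n"
  proof -
    have "2 powr K \<le> n" using K(2) n by (simp add: le_log_iff)
    then show ?thesis by (simp add: powr_realpow)
  qed
  note le = two_power_le[OF this]
  obtain dec where dec: "\<And>A q. A \<in> arrays m n \<Longrightarrow> q \<in> one_sided_queries m n \<Longrightarrow> dec (enc A) q = RMQ A q"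
    using assms(3) unfolding is_encoding_def by blast
  define g where "g w k = snd (dec w (left_block m (2 ^ k)))" for w k
  have g: "snd (RMQ A (left_block m (2 ^ k))) = g (enc A) k" if "A \<in> arrays m n" "k \<in> {1..K}" for A k
    using that le dec[of A "left_block m (2 ^ k)"] by (auto simp: g_def one_sided_queries_eq)
  let ?W = "\<lambda>A. dyadic_weight K (g (enc A))"
  have meas: "(\<lambda>A. h (enc A)) \<in> borel_measurable ?M" for h :: "bool list \<Rightarrow> ennreal"
    by (rule measurable_compose[OF enc]) simp
  have "(\<integral>\<^sup>+ A. 1 \<partial>?M) \<le> ?I"
  proof (rule nn_integral_mono)
    fix A assume "A \<in> space ?M"
    then have "enc A \<noteq> []" using nonempty_codeword[OF ud] by auto
    then have "1 \<le> length (enc A)" by (cases "enc A") auto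
    then show "1 \<le> (of_nat (length (enc A)) :: ennreal)"
      by (metis of_nat_1 of_nat_mono)
  qed
  then have I1: "1 \<le> ?I" by (simp add: emeasure_space_1 del: space_random_array)
  have "ennreal (real K * (real K - 1) / 4) \<le> (\<integral>\<^sup>+ A. ennreal (?W A) \<partial>?M)"
  proof -
    have "dyadic_weight K (\<lambda>k. snd (RMQ A (left_block m (2 ^ k)))) = ?W A" if "A \<in> space ?M" for A
      unfolding dyadic_weight_def using that g by (intro sum.cong) auto
    then have "(\<integral>\<^sup>+ A. ennreal (?W A) \<partial>?M) =
       (\<integral>\<^sup>+ A. ennreal (dyadic_weight K (\<lambda>k. snd (RMQ A (left_block m (2 ^ k))))) \<partial>?M)"
      by (intro nn_integral_cong) simp
    then show ?thesis using nn_integral_dyadic_weight_ge[OF \<open>2 ^ K \<le> n\<close>, of m] assms by simp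
  qed
  also have "\<dots> \<le> (\<integral>\<^sup>+ A. ennreal (2 ^ ?W A * (1/4) ^ length (enc A)) + 2 * of_nat (length (enc A)) \<partial>?M)"
  proof (rule nn_integral_mono)
    fix A
    let ?l = "length (enc A)"
    \<comment> \<open>This is \<open>t \<le> 2 powr t\<close> for \<open>t = W - 2 * l\<close>,
      split by sign to stay with natural exponents.\<close>
    have "real (?W A) \<le> 2 ^ ?W A * (1/4) ^ ?l + 2 * real ?l"
    proof (cases "2 * ?l \<le> ?W A")
      case True
      then obtain d where d: "?W A = 2 * ?l + d" by (auto simp: le_iff_add)
      then have "2 ^ ?W A * (1/4) ^ ?l = (2::real) ^ d"
        by (simp add: power_add power_mult power_one_over)
      then show ?thesis using d of_nat_less_two_power[of d, where 'a = real] by simp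
    next
      case False
      then have "real (?W A) \<le> 2 * real ?l" by linarith
      then show ?thesis by (smt (verit) mult_nonneg_nonneg zero_le_power zero_le_divide_1_iff)
    qed
    then have "ennreal (?W A) \<le> ennreal (2 ^ ?W A * (1/4) ^ ?l + 2 * real ?l)" by (rule ennreal_leI)
    also have "\<dots> = ennreal (2 ^ ?W A * (1/4) ^ ?l) + 2 * of_nat ?l"
      by (simp add: ennreal_mult ennreal_of_nat_eq_real_of_nat)
    finally show "ennreal (?W A) \<le> ennreal (2 ^ ?W A * (1/4) ^ ?l) + 2 * of_nat ?l" .
  qed
  also have "\<dots> = (\<integral>\<^sup>+ A. ennreal (2 ^ ?W A * (1/4) ^ length (enc A)) \<partial>?M) + 2 * ?I"
    using nn_integral_add[OF meas[of "\<lambda>w. ennreal (2 ^ dyadic_weight K (g w) * (1/4) ^ length w)"]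
        meas[of "\<lambda>w. 2 * of_nat (length w)"]]
      nn_integral_cmult[OF meas[of "\<lambda>w. of_nat (length w)"], of 2] by simp
  also have "\<dots> \<le> 2 + 2 * ?I"
    by (intro add_right_mono nn_integral_dyadic_weight_le[OF \<open>2 ^ K \<le> n\<close> _ enc g]) (use assms in auto)
  finally have I2: "ennreal (real K * (real K - 1) / 4) \<le> 2 + 2 * ?I" .
  show ?thesis
  proof (cases ?I)
    case (real I)
    have "1 \<le> I" using I1 real by simp
    moreover have "real K * (real K - 1) / 4 \<le> 2 + 2 * I"
    proof -
      have "ennreal (real K * (real K - 1) / 4) \<le> ennreal (2 + 2 * I)"
        using I2 real by (simp add: ennreal_mult)
      then show ?thesis using real by (subst (asm) ennreal_le_iff) auto
    qed
    moreover have "(log 2 n)\<^sup>2 \<le> (real K + 1)\<^sup>2"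
      using K log1 by (intro power_mono) auto
    \<comment> \<open>With \<open>K * (K - 1) \<le> 8 + 8 * I\<close> this gives
      \<open>(K + 1)\<^sup>2 \<le> 25 + 16 * I\<close>, which is at most \<open>41 * I\<close> since
      \<open>1 \<le> I\<close>.\<close>
    moreover have "(real K + 1)\<^sup>2 \<le> 2 * (real K * (real K - 1)) + 9"
    proof -
      have "0 \<le> (real K - 2)\<^sup>2 + 4" by simp
      then show ?thesis by (simp add: power2_eq_square algebra_simps)
    qed
    ultimately have "(log 2 n)\<^sup>2 / 41 \<le> I" by simp
    then show ?thesis using real by (simp add: ennreal_leI)
  qed simp
qed

subsection \<open>Upper bound\<close>

definition framed :: "('a \<Rightarrow> bool list) \<Rightarrow> 'a list \<Rightarrow> bool list" where
  "framed \<phi> xs = concat (map (\<lambda>x. True # \<phi> x) xs) @ [False]"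

lemma length_framed:
  "(\<And>x. x \<in> set xs \<Longrightarrow> length (\<phi> x) = b) \<Longrightarrow> length (framed \<phi> xs) = length xs * (b + 1) + 1"
  by (induction xs) (auto simp: framed_def)

text \<open>The leading bit tells whether another item follows, and an item takes exactly
  \<open>b\<close> bits. Arbitrary continuations \<open>u\<close> and \<open>v\<close> make this a
  prefix property.\<close>

lemma framed_append_inj:
  assumes \<phi>: "inj_on \<phi> S" "\<And>x. x \<in> S \<Longrightarrow> length (\<phi> x) = b"
    and "set xs \<subseteq> S" "set ys \<subseteq> S" "framed \<phi> xs @ u = framed \<phi> ys @ v"
  shows "xs = ys \<and> u = v"
  using assms(3-)
proof (induction xs arbitrary: ys)
  case Nil
  then show ?case by (cases ys) (auto simp: framed_def)
next
  case (Cons x xs)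
  then obtain y ys' where ys: "ys = y # ys'" by (cases ys) (auto simp: framed_def)
  have "\<phi> x @ framed \<phi> xs @ u = \<phi> y @ framed \<phi> ys' @ v"
    using Cons.prems by (simp add: ys framed_def)
  moreover have "length (\<phi> x) = length (\<phi> y)" using Cons.prems \<phi>(2) by (simp add: ys)
  ultimately have "\<phi> x = \<phi> y" "framed \<phi> xs @ u = framed \<phi> ys' @ v" by simp_all
  then show ?case using Cons \<phi>(1) by (auto simp: ys dest: inj_onD)
qed

text \<open>Decoding runs from left to right: each codeword determines where it ends. As each ends
  in \<open>False\<close>, none is empty.\<close>

lemma uniquely_decodable_framed:
  assumes \<phi>: "inj_on \<phi> S" "\<And>x. x \<in> S \<Longrightarrow> length (\<phi> x) = b"
    and C: "C \<subseteq> framed \<phi> ` lists S"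
  shows "uniquely_decodable C"
  unfolding uniquely_decodable_def
proof (rule inj_onI)
  have ne: "w \<noteq> []" if "w \<in> C" for w using that C by (auto simp: framed_def)
  fix ws ws' assume "ws \<in> lists C" "ws' \<in> lists C" "concat ws = concat ws'"
  then show "ws = ws'"
  proof (induction ws arbitrary: ws' rule: list.induct)
    case Nil
    then show ?case using ne by (cases ws') auto
  next
    case (Cons w ws)
    then obtain w' vs where ws': "ws' = w' # vs" using ne by (cases ws') auto
    have "w \<in> framed \<phi> ` lists S" "w' \<in> framed \<phi> ` lists S"
      using Cons.prems C by (auto simp: ws')
    then obtain xs ys where "w = framed \<phi> xs" "w' = framed \<phi> ys" "set xs \<subseteq> S" "set ys \<subseteq> S"
      by (auto simp: lists_eq_set)
    then have "w = w' \<and> concat ws = concat vs"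
      using framed_append_inj[OF \<phi>, of xs ys "concat ws" "concat vs"] Cons.prems(3) by (auto simp: ws')
    then show ?case using Cons.IH[of vs] Cons.prems by (simp add: ws')
  qed
qed

lemma ex_fixed_length_code:
  assumes "finite S" "card S \<le> 2 ^ b"
  shows "\<exists>\<phi> :: 'a \<Rightarrow> bool list. inj_on \<phi> S \<and> (\<forall>x\<in>S. length (\<phi> x) = b)"
proof -
  have "card {w :: bool list. length w = b} = 2 ^ b" "finite {w :: bool list. length w = b}"
    using card_lists_length_eq[of "UNIV :: bool set" b] finite_lists_length_eq[of "UNIV :: bool set" b]
    by simp_all
  then obtain \<phi> where "\<phi> ` S \<subseteq> {w :: bool list. length w = b}" "inj_on \<phi> S"
    using card_le_inj[OF assms(1), of "{w :: bool list. length w = b}"] assms(2) by auto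
  then show ?thesis by blast
qed

section \<open>Encoding the changes of the answer\<close>

text \<open>The first block is counted explicitly, because the answer on the empty block before it
  is an arbitrary value.\<close>

definition is_change :: "nat \<Rightarrow> (position \<Rightarrow> real) \<Rightarrow> nat \<Rightarrow> bool" where
  "is_change m A j \<longleftrightarrow> j = 1 \<or> RMQ A (left_block m j) \<noteq> RMQ A (left_block m (j - 1))"

definition changes :: "nat \<Rightarrow> nat \<Rightarrow> (position \<Rightarrow> real) \<Rightarrow> (nat \<times> position) list" where
  "changes m n A = map (\<lambda>j. (j, RMQ A (left_block m j))) (filter (is_change m A) [1..<Suc n])"

lemma changes_subset: "1 \<le> m \<Longrightarrow> set (changes m n A) \<subseteq> {1..n} \<times> positions m n"
proof -
  assume "1 \<le> m"
  have "RMQ A (left_block m j) \<in> positions m n" if "j \<in> {1..n}" for j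
  proof -
    have "left_block m j \<noteq> {}" using that \<open>1 \<le> m\<close> by (auto simp: left_block_def)
    then have "RMQ A (left_block m j) \<in> left_block m j" by (intro RMQ_is_max) auto
    then show ?thesis using left_block_subset[of j n m] that by auto
  qed
  then show ?thesis by (auto simp: changes_def)
qed

lemma RMQ_eq_if_changes_eq:
  assumes "changes m n A = changes m n A'" "j \<in> {1..n}"
  shows "RMQ A (left_block m j) = RMQ A' (left_block m j)"
  using assms(2)
proof (induction j)
  case (Suc j)
  have set: "(i, p) \<in> set (changes m n B) \<longleftrightarrow>
      i \<in> {1..n} \<and> is_change m B i \<and> p = RMQ B (left_block m i)" for i p B
    by (auto simp: changes_def)
  show ?case
  proof (cases "is_change m A (Suc j)")
    case True
    then have "(Suc j, RMQ A (left_block m (Suc j))) \<in> set (changes m n A)"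
      using Suc.prems by (subst set) auto
    then show ?thesis unfolding assms(1) set by simp
  next
    case False
    then have "\<not> is_change m A' (Suc j)"
      using Suc.prems assms(1) set[of "Suc j" _ A] set[of "Suc j" _ A'] by metis
    \<comment> \<open>Both answers are inherited from \<open>j\<close>; here \<open>j\<close> is
      positive because the first block always counts as a change.\<close>
    then show ?thesis using False Suc by (auto simp: is_change_def)
  qed
qed simp

text \<open>Such an \<open>f\<close> factors through the pattern of comparisons between entries,
  which takes finitely many values, each on a measurable set.\<close>

lemma measurable_order_invariant:
  assumes inv: "\<And>A A'. A \<in> arrays m n \<Longrightarrow> A' \<in> arrays m n \<Longrightarrow>
    (\<And>p p'. p \<in> positions m n \<Longrightarrow> p' \<in> positions m n \<Longrightarrow> A p \<le> A p' \<longleftrightarrow> A' p \<le> A' p') \<Longrightarrow> f A = f A'"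
  shows "f \<in> random_array m n \<rightarrow>\<^sub>M count_space UNIV"
proof -
  let ?M = "random_array m n" and ?P = "positions m n \<times> positions m n"
  define R where "R A = {z \<in> ?P. A (fst z) \<le> A (snd z)}" for A :: "position \<Rightarrow> real"
  have "R \<in> ?M \<rightarrow>\<^sub>M count_space (Pow ?P)"
  proof (subst measurable_count_space_eq2, simp, intro conjI ballI)
    show "R \<in> space ?M \<rightarrow> Pow ?P" by (auto simp: R_def)
    fix S assume S: "S \<in> Pow ?P"
    have "{z \<in> X. Q z} = S \<longleftrightarrow> (\<forall>z\<in>X. Q z \<longleftrightarrow> z \<in> S)" if "S \<subseteq> X"
      for X :: "(position \<times> position) set" and Q
      using that by blast
    note this[OF S[unfolded Pow_iff]]
    then have "R -` {S} \<inter> space ?M = {A \<in> space ?M. \<forall>z\<in>?P. A (fst z) \<le> A (snd z) \<longleftrightarrow> z \<in> S}"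
      unfolding R_def vimage_def by (simp only: singleton_iff) blast
    moreover have "Measurable.pred ?M (\<lambda>A. \<forall>z\<in>?P. A (fst z) \<le> A (snd z) \<longleftrightarrow> z \<in> S)"
    proof (rule pred_intros_finite)
      fix z assume "z \<in> ?P"
      then have "Measurable.pred ?M (\<lambda>A. A (fst z) \<le> A (snd z))"
        unfolding pred_def by (intro borel_measurable_le measurable_entry) auto
      then show "Measurable.pred ?M (\<lambda>A. A (fst z) \<le> A (snd z) \<longleftrightarrow> z \<in> S)"
        by (cases "z \<in> S") (auto intro: pred_intros_logic)
    qed simp
    ultimately show "R -` {S} \<inter> space ?M \<in> sets ?M" by (simp add: pred_def)
  qed
  \<comment> \<open>The second factor evaluates \<open>f\<close> at a representative array with the
    given pattern.\<close>
  from measurable_compose[OF this, of "\<lambda>S. f (SOME A'. A' \<in> arrays m n \<and> R A' = S)" "count_space UNIV"]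
  have "(\<lambda>A. f (SOME A'. A' \<in> arrays m n \<and> R A' = R A)) \<in> ?M \<rightarrow>\<^sub>M count_space UNIV"
    by simp
  moreover have "f (SOME A'. A' \<in> arrays m n \<and> R A' = R A) = f A" if "A \<in> space ?M" for A
  proof -
    define B where "B = (SOME A'. A' \<in> arrays m n \<and> R A' = R A)"
    have "B \<in> arrays m n \<and> R B = R A"
      unfolding B_def by (rule someI[of _ A]) (use that in simp)
    then have "f B = f A"
      using that by (intro inv) (auto simp: R_def set_eq_iff)
    then show ?thesis by (simp add: B_def)
  qed
  ultimately show ?thesis
    using measurable_cong[of ?M "\<lambda>A. f (SOME A'. A' \<in> arrays m n \<and> R A' = R A)" f "count_space UNIV"]
    by blast
qed

lemma measurable_changes: "changes m n \<in> random_array m n \<rightarrow>\<^sub>M count_space UNIV"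
proof (rule measurable_order_invariant)
  fix A A' :: "position \<Rightarrow> real"
  assume A: "\<And>p p'. p \<in> positions m n \<Longrightarrow> p' \<in> positions m n \<Longrightarrow> A p \<le> A p' \<longleftrightarrow> A' p \<le> A' p'"
  have RMQ: "RMQ A (left_block m j) = RMQ A' (left_block m j)" if "j \<le> n" for j
  proof -
    have "x \<in> left_block m j \<and> (\<forall>y\<in>left_block m j. A y \<le> A x) \<longleftrightarrow>
        x \<in> left_block m j \<and> (\<forall>y\<in>left_block m j. A' y \<le> A' x)" for x
      using left_block_subset[OF that, of m] A by blast
    then show ?thesis by (simp add: RMQ_eq_Eps)
  qed
  then have "is_change m A j = is_change m A' j" if "j \<in> set [1..<Suc n]" for j
    using that by (auto simp: is_change_def)
  then have "filter (is_change m A) [1..<Suc n] = filter (is_change m A') [1..<Suc n]"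
    by (intro filter_cong) auto
  then show "changes m n A = changes m n A'"
    unfolding changes_def using RMQ by (auto intro!: map_cong)
qed

text \<open>If the maximum lay in an earlier column, it would already be the answer one block
  before.\<close>

lemma max_column_if_change:
  assumes inj: "inj_on A (positions m n)" and m: "1 \<le> m" and j: "j \<in> {1..n}" and "is_change m A j"
  shows "max_column m j j A"
proof -
  let ?p = "RMQ A (left_block m j)"
  have ne: "left_block m i \<noteq> {}" if "1 \<le> i" for i using m that by (auto simp: left_block_def)
  have p: "?p \<in> left_block m j" "\<And>q. q \<in> left_block m j \<Longrightarrow> A q \<le> A ?p"
    using RMQ_is_max[OF finite_left_block ne] j by auto
  have "snd ?p = j"
  proof (rule ccontr)
    assume "snd ?p \<noteq> j"
    with p(1) have p': "?p \<in> left_block m (j - 1)" and j2: "1 \<le> j - 1"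
      by (auto simp: left_block_def)
    let ?q = "RMQ A (left_block m (j - 1))"
    have q: "?q \<in> left_block m (j - 1)" "A ?p \<le> A ?q"
      using RMQ_is_max[OF finite_left_block ne[OF j2]] p' by blast+
    have "?q \<in> left_block m j" using q(1) by (auto simp: left_block_def)
    then have "A ?q = A ?p" using p q by (simp add: antisym)
    then have "?q = ?p"
      using inj p(1) \<open>?q \<in> left_block m j\<close> left_block_subset[of j n m] j by (auto dest: inj_onD)
    then show False using assms(4) j2 by (auto simp: is_change_def)
  qed
  then show ?thesis using max_column_RMQ[OF inj m j] by simp
qed

text \<open>By linearity of expectation the harmonic sum bounds the expected number of
  changes.\<close>

lemma expected_number_of_changes_le:
  assumes "1 \<le> m" "1 \<le> n"
  shows "(\<integral>\<^sup>+ A. of_nat (length (changes m n A)) \<partial>random_array m n) \<le> ennreal (1 + ln n)"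
proof -
  let ?M = "random_array m n"
  interpret prob_space ?M by (rule prob_space_random_array)
  let ?S = "\<lambda>j. {A \<in> arrays m n. max_column m j j A}"
  have S: "?S j \<in> events" if "j \<in> {1..n}" for j
    using measurable_max_column[of j n m j] that by (simp add: pred_def)
  have "(\<integral>\<^sup>+ A. of_nat (length (changes m n A)) \<partial>?M) \<le> (\<integral>\<^sup>+ A. (\<Sum>j=1..n. indicator (?S j) A) \<partial>?M)"
  proof (rule nn_integral_mono_AE)
    show "AE A in ?M. of_nat (length (changes m n A)) \<le> (\<Sum>j=1..n. indicator (?S j) A :: ennreal)"
      using AE_random_array_inj[of m n] AE_space
    proof eventually_elim
      case (elim A)
      have "length (changes m n A) = card {j \<in> {1..n}. is_change m A j}"
        by (auto simp: changes_def distinct_length_filter simp del: upt_Suc intro!: arg_cong[of _ _ card])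
      also have "\<dots> \<le> card {j \<in> {1..n}. A \<in> ?S j}"
        using max_column_if_change[OF elim(1) assms(1)] elim(2) by (intro card_mono) auto
      finally have "of_nat (length (changes m n A)) \<le> (of_nat (card {j \<in> {1..n}. A \<in> ?S j}) :: ennreal)"
        by (rule of_nat_mono)
      also have "\<dots> = (\<Sum>j=1..n. indicator (?S j) A)"
        by (simp add: indicator_def sum.If_cases Int_def)
      finally show ?case .
    qed
  qed
  also have "\<dots> = (\<Sum>j=1..n. emeasure ?M (?S j))"
    using S by (subst nn_integral_sum) auto
  also have "\<dots> = ennreal (\<Sum>j=1..n. prob (?S j))"
    by (simp add: emeasure_eq_measure)
  also have "\<dots> \<le> ennreal (\<Sum>j=1..n. 1 / real j)"
    by (intro ennreal_leI sum_mono prob_max_column_le_inverse) auto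
  also have "(\<Sum>j=1..n. 1 / real j) = harm n" by (simp add: harm_def inverse_eq_divide)
  \<comment> \<open>The difference of \<open>harm k\<close> and \<open>ln k\<close> decreases from
    its value 1 at \<open>k = 1\<close>; the sequence is indexed from 0, hence
    \<open>n - 1\<close>.\<close>
  also have "harm n \<le> 1 + ln (real n)"
    using decseqD[OF decseq_harm_diff_ln, of 0 "n - 1"] assms by (simp add: harm_def)
  finally show ?thesis by (simp add: ennreal_leI)
qed

text \<open>Each change costs \<open>b\<close> bits for its place and answer and one marker bit; a
  final bit ends the list.\<close>

lemma ex_short_encoding:
  assumes "1 \<le> m" "1 \<le> n" "n * (m * n) \<le> 2 ^ b"
  shows "\<exists>enc. is_encoding m n (one_sided_queries m n) enc \<and> uniquely_decodable (enc ` arrays m n) \<and>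
    enc \<in> random_array m n \<rightarrow>\<^sub>M count_space UNIV \<and>
    (\<integral>\<^sup>+ A. of_nat (length (enc A)) \<partial>random_array m n) \<le> ennreal ((1 + ln n) * (real b + 1) + 1)"
proof -
  let ?M = "random_array m n"
  interpret prob_space ?M by (rule prob_space_random_array)
  let ?S = "{1..n} \<times> positions m n"
  have "card ?S \<le> 2 ^ b" using assms by (simp add: positions_def card_cartesian_product)
  then obtain \<phi> :: "nat \<times> position \<Rightarrow> bool list"
    where \<phi>: "inj_on \<phi> ?S" "\<And>x. x \<in> ?S \<Longrightarrow> length (\<phi> x) = b"
    using ex_fixed_length_code[of ?S b] by auto
  define enc where "enc A = framed \<phi> (changes m n A)" for A
  note sub = changes_subset[OF assms(1), of n]
  have "is_encoding m n (one_sided_queries m n) enc"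
    unfolding is_encoding_def
  proof (intro exI ballI)
    fix A q assume A: "A \<in> arrays m n" and "q \<in> one_sided_queries m n"
    then obtain j where j: "j \<in> {1..n}" "q = left_block m j" by (auto simp: one_sided_queries_eq)
    \<comment> \<open>The decoder answers from any array with the received codeword; such an array
      has the same changes.\<close>
    define B where "B = (SOME B. B \<in> arrays m n \<and> enc B = enc A)"
    have "B \<in> arrays m n \<and> enc B = enc A"
      unfolding B_def by (rule someI[of _ A]) (use A in simp)
    then have "changes m n B = changes m n A"
      using framed_append_inj[OF \<phi> sub sub, of B "[]" A "[]"] by (simp add: enc_def)
    then show "RMQ (SOME B. B \<in> arrays m n \<and> enc B = enc A) q = RMQ A q"
      unfolding B_def[symmetric] j(2) by (rule RMQ_eq_if_changes_eq[OF _ j(1)])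
  qed
  moreover have "uniquely_decodable (enc ` arrays m n)"
    by (rule uniquely_decodable_framed[OF \<phi>]) (use sub in \<open>auto simp: enc_def\<close>)
  moreover have "enc \<in> ?M \<rightarrow>\<^sub>M count_space UNIV"
    unfolding enc_def by (rule measurable_compose[OF measurable_changes]) simp
  moreover have "(\<integral>\<^sup>+ A. of_nat (length (enc A)) \<partial>?M) \<le> ennreal ((1 + ln n) * (real b + 1) + 1)"
  proof -
    have len: "length (enc A) = length (changes m n A) * (b + 1) + 1" for A
      unfolding enc_def by (intro length_framed \<phi>) (use sub in auto)
    have [measurable]: "(\<lambda>A. of_nat (length (changes m n A)) :: ennreal) \<in> borel_measurable ?M"
      by (rule measurable_compose[OF measurable_changes]) simp
    have "(\<integral>\<^sup>+ A. of_nat (length (enc A)) \<partial>?M) =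
        (\<integral>\<^sup>+ A. of_nat (length (changes m n A)) \<partial>?M) * of_nat (b + 1) + 1"
      unfolding len of_nat_add of_nat_mult
      by (simp add: nn_integral_add nn_integral_multc emeasure_space_1 del: space_random_array)
    also have "\<dots> \<le> ennreal (1 + ln n) * of_nat (b + 1) + 1"
      by (intro add_right_mono mult_right_mono expected_number_of_changes_le assms) auto
    also have "\<dots> = ennreal ((1 + ln n) * (real b + 1) + 1)"
      using assms unfolding ennreal_of_nat_eq_real_of_nat by (simp add: ennreal_mult add.commute)
    finally show ?thesis .
  qed
  ultimately show ?thesis by blast
qed

text \<open>The bounds hold with constants \<open>1 / 41\<close> and \<open>11\<close> for every
  admissible pair, which is what the principal filter demands.\<close>

theorem theorem3:
  "(\<lambda>(m, n). enn2real
      (expected_effective_entropy m n (random_array m n) (one_sided_queries m n)))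
   \<in> \<Theta>[principal {(m :: nat, n :: nat). 2 \<le> m \<and> m \<le> n}](\<lambda>(m, n). (log 2 (real n))\<^sup>2)"
proof -
  let ?H = "\<lambda>m n. expected_effective_entropy m n (random_array m n) (one_sided_queries m n)"
  have lower: "ennreal ((log 2 n)\<^sup>2 / 41) \<le> ?H m n" if "2 \<le> m" "m \<le> n" for m n
    unfolding expected_effective_entropy_def
    by (rule INF_greatest) (use expected_length_ge[OF that] in auto)
  have upper: "?H m n \<le> ennreal (11 * (log 2 n)\<^sup>2)" if "2 \<le> m" "m \<le> n" for m n
  proof -
    define L where "L = log 2 n"
    have n: "2 \<le> n" and n1: "1 \<le> m" "1 \<le> n" using that by simp_all
    have L: "1 \<le> L" using n by (simp add: L_def le_log_iff)
    \<comment> \<open>There are \<open>n * (m * n)\<close> possible items, at most the cube of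
      \<open>n\<close>, that is \<open>2 powr (3 * L)\<close>.\<close>
    define b where "b = nat \<lceil>3 * L\<rceil>"
    have b: "3 * L \<le> real b" "real b \<le> 3 * L + 1" using L unfolding b_def by linarith+
    have "real (n * (m * n)) \<le> real n ^ 3"
      using that by (simp add: power3_eq_cube mult_mono)
    also have "\<dots> = 2 powr (3 * L)"
      using n by (simp add: L_def powr_powr[symmetric] mult.commute[of 3] powr_numeral)
    also have "\<dots> \<le> 2 powr b" using b by (intro powr_mono) auto
    also have "\<dots> = real (2 ^ b)" by (simp add: powr_realpow)
    finally have card: "n * (m * n) \<le> 2 ^ b" by (simp only: of_nat_le_iff)
    obtain enc where "is_encoding m n (one_sided_queries m n) enc" "uniquely_decodable (enc ` arrays m n)"
        "enc \<in> random_array m n \<rightarrow>\<^sub>M count_space UNIV"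
        and le: "(\<integral>\<^sup>+ A. of_nat (length (enc A)) \<partial>random_array m n) \<le> ennreal ((1 + ln n) * (real b + 1) + 1)"
      using ex_short_encoding[OF n1 card] by blast
    then have "?H m n \<le> (\<integral>\<^sup>+ A. of_nat (length (enc A)) \<partial>random_array m n)"
      unfolding expected_effective_entropy_def by (intro INF_lower) auto
    also note le
    \<comment> \<open>As \<open>1 \<le> L\<close>, the left side is at most
      \<open>6 * L\<^sup>2 + 4 * L + 1\<close>; whence \<open>11 = 6 + 4 + 1\<close>.\<close>
    also have "(1 + ln n) * (real b + 1) + 1 \<le> 11 * L\<^sup>2"
    proof -
      have "ln n \<le> L"
        using n ln_2_less_1 by (simp add: L_def log_def field_simps mult_left_le)
      then have "(1 + ln n) * (real b + 1) \<le> (2 * L) * (3 * L + 2)"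
        using L b n by (intro mult_mono) auto
      also have "\<dots> + 1 \<le> 11 * L\<^sup>2"
      proof -
        have "1 * L \<le> L * L" using L by (intro mult_right_mono) auto
        moreover have "(2 * L) * (3 * L + 2) = 6 * (L * L) + 4 * L" by (simp add: algebra_simps)
        ultimately show ?thesis using L unfolding power2_eq_square by linarith
      qed
      finally show ?thesis by simp
    qed
    finally show ?thesis unfolding L_def by (simp add: ennreal_leI)
  qed
  \<comment> \<open>Since \<open>enn2real\<close> maps infinity to 0, the lower bound transfers to
    the reals only with finiteness.\<close>
  have fin: "?H m n < \<top>" if "2 \<le> m" "m \<le> n" for m n
    using upper[OF that] by (simp add: order_le_less_trans)
  show ?thesis
  proof (rule bigthetaI)
    show "(\<lambda>(m, n). enn2real (?H m n)) \<in> O[principal {(m, n). 2 \<le> m \<and> m \<le> n}](\<lambda>(m, n). (log 2 (real n))\<^sup>2)"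
    proof (rule bigoI[of _ 11], unfold eventually_principal, clarify)
      fix m n :: nat assume mn: "2 \<le> m" "m \<le> n"
      show "norm (enn2real (?H m n)) \<le> 11 * norm ((log 2 (real n))\<^sup>2)"
        using enn2real_mono[OF upper[OF mn]] by simp
    qed
    show "(\<lambda>(m, n). enn2real (?H m n)) \<in> \<Omega>[principal {(m, n). 2 \<le> m \<and> m \<le> n}](\<lambda>(m, n). (log 2 (real n))\<^sup>2)"
    proof (rule landau_omega.bigI[of "1 / 41"], simp, unfold eventually_principal, clarify)
      fix m n :: nat assume mn: "2 \<le> m" "m \<le> n"
      show "norm (enn2real (?H m n)) \<ge> 1 / 41 * norm ((log 2 (real n))\<^sup>2)"
        using enn2real_mono[OF lower[OF mn] fin[OF mn]] by simp
    qed
  qed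
qed

end
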